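(* Let $p$ be an odd prime and let $G=\langle a,b,c \mid a^p=b^p=c^p=1,\ [a,b]=c,\ [c,a]=[c,b]=1\rangle$. Let $\Sigma=\mathrm{Cos}(G,\langle a\rangle,\langle b\rangle)$ be the graph with vertex set $\{\langle a\rangle g\mid g\in G\}\cup\{\langle b\rangle h\mid h\in G\}$ and with edges all the coset pairs $\{\langle a\rangle g,\langle b\rangle h\}$ such that $\langle a\rangle g\cap\langle b\rangle h\neq\emptyset$. Then $\Sigma$ is $3$-arc-regular, that is, $\mathrm{Aut}(\Sigma)$ is regular on the set of $3$-arcs of $\Sigma$.
   Context: All graphs are finite, simple and undirected, and $\mathrm{Aut}(\Sigma)$ is the full automorphism group of $\Sigma$. Here $[x,y]=x^{-1}y^{-1}xy$. A $3$-arc of a graph $\Sigma$ is a sequence $v_0,v_1,v_2,v_3$ of vertices such that $v_{i-1},v_i$ are adjacent for $1\le i\le 3$ and $v_{i-1}\neq v_{i+1}$ for $1\le i\le 2$. A group action is regular if it is transitive and all point stabilizers are trivial. *)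

theory Defs
  imports "HOL-Computational_Algebra.Primes" "HOL-Algebra.Group_Action" "HOL-Algebra.Generated_Groups"
begin

section \<open>Groups given by generators and relations\<close>

text \<open>
  A word is a list of letters \<open>(x, e)\<close>; the letter \<open>(x, False)\<close> is the generator \<open>x\<close> and
  \<open>(x, True)\<close> is its formal inverse. Every element of the type \<open>'x\<close> is a generator.
  A relation \<open>u = v\<close> is the pair \<open>(u, v)\<close>.
\<close>

type_synonym 'x word = "('x \<times> bool) list"

definition gen_word :: "'x \<Rightarrow> 'x word" where
  "gen_word x = [(x, False)]"

definition word_inv :: "'x word \<Rightarrow> 'x word" where
  "word_inv w = rev (map (\<lambda>(x, e). (x, \<not> e)) w)"

definition word_pow :: "'x word \<Rightarrow> nat \<Rightarrow> 'x word" where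
  "word_pow w n = concat (replicate n w)"

definition word_comm :: "'x word \<Rightarrow> 'x word \<Rightarrow> 'x word" where
  "word_comm u v = word_inv u @ word_inv v @ u @ v"

inductive pres_eq :: "('x word \<times> 'x word) set \<Rightarrow> 'x word \<Rightarrow> 'x word \<Rightarrow> bool"
  for R where
  relation: "(u, v) \<in> R \<Longrightarrow> pres_eq R u v"
| cancel: "pres_eq R [(x, e), (x, \<not> e)] []"
| refl: "pres_eq R u u"
| sym: "pres_eq R u v \<Longrightarrow> pres_eq R v u"
| trans: "pres_eq R u v \<Longrightarrow> pres_eq R v w \<Longrightarrow> pres_eq R u w"
| append: "pres_eq R u u' \<Longrightarrow> pres_eq R v v' \<Longrightarrow> pres_eq R (u @ v) (u' @ v')"

definition pres_class :: "('x word \<times> 'x word) set \<Rightarrow> 'x word \<Rightarrow> 'x word set" where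
  "pres_class R w = {u. pres_eq R w u}"

definition presented_group :: "('x word \<times> 'x word) set \<Rightarrow> 'x word set monoid" where
  "presented_group R =
    \<lparr>carrier = range (pres_class R),
     monoid.mult = (\<lambda>X Y. \<Union>u\<in>X. \<Union>v\<in>Y. pres_class R (u @ v)),
     one = pres_class R []\<rparr>"

lemma pres_class_eq_iff: "pres_class R u = pres_class R v \<longleftrightarrow> pres_eq R u v"
  unfolding pres_class_def by (metis (mono_tags, lifting) Collect_cong mem_Collect_eq
      pres_eq.refl pres_eq.sym pres_eq.trans)

lemma presented_group_mult:
  "pres_class R u \<otimes>\<^bsub>presented_group R\<^esub> pres_class R v = pres_class R (u @ v)"
proof -
  have "pres_class R (u' @ v') = pres_class R (u @ v)"
    if "u' \<in> pres_class R u" "v' \<in> pres_class R v" for u' v'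
    using that unfolding pres_class_eq_iff
    by (simp add: pres_class_def pres_eq.append pres_eq.sym)
  moreover have "u \<in> pres_class R u" "v \<in> pres_class R v"
    by (simp_all add: pres_class_def pres_eq.refl)
  ultimately have "(\<Union>u'\<in>pres_class R u. \<Union>v'\<in>pres_class R v. pres_class R (u' @ v')) = pres_class R (u @ v)"
    by blast
  then show ?thesis
    by (simp add: presented_group_def)
qed

lemma pres_eq_word_inv: "pres_eq R (word_inv w @ w) []"
proof (induction w)
  case Nil
  show ?case by (simp add: word_inv_def pres_eq.refl)
next
  case (Cons l w)
  obtain x e where l: "l = (x, e)" by (cases l)
  have "pres_eq R [(x, \<not> e), (x, e)] []"
    using pres_eq.cancel[of R x "\<not> e"] by simp
  then have "pres_eq R ([(x, \<not> e), (x, e)] @ w) ([] @ w)"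
    by (rule pres_eq.append) (rule pres_eq.refl)
  then have "pres_eq R (word_inv w @ ([(x, \<not> e), (x, e)] @ w)) (word_inv w @ ([] @ w))"
    by (rule pres_eq.append[OF pres_eq.refl])
  then have "pres_eq R (word_inv (l # w) @ l # w) (word_inv w @ w)"
    by (simp add: word_inv_def l)
  then show ?case using Cons.IH by (rule pres_eq.trans)
qed

lemma group_presented_group: "group (presented_group R)"
proof (rule groupI)
  have one: "\<one>\<^bsub>presented_group R\<^esub> = pres_class R []"
    and carrier: "carrier (presented_group R) = range (pres_class R)"
    by (simp_all add: presented_group_def)
  show "\<one>\<^bsub>presented_group R\<^esub> \<in> carrier (presented_group R)"
    by (simp add: one carrier)
  fix X assume "X \<in> carrier (presented_group R)"
  then obtain u where X: "X = pres_class R u" by (auto simp: carrier)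
  show "\<one>\<^bsub>presented_group R\<^esub> \<otimes>\<^bsub>presented_group R\<^esub> X = X"
    by (simp add: X one presented_group_mult)
  show "\<exists>Y\<in>carrier (presented_group R). Y \<otimes>\<^bsub>presented_group R\<^esub> X = \<one>\<^bsub>presented_group R\<^esub>"
    by (rule bexI[of _ "pres_class R (word_inv u)"])
      (auto simp: X one carrier presented_group_mult pres_class_eq_iff pres_eq_word_inv)
  fix Y assume "Y \<in> carrier (presented_group R)"
  then obtain v where Y: "Y = pres_class R v" by (auto simp: carrier)
  show "X \<otimes>\<^bsub>presented_group R\<^esub> Y \<in> carrier (presented_group R)"
    by (simp add: X Y carrier presented_group_mult)
  fix Z assume "Z \<in> carrier (presented_group R)"
  then obtain w where Z: "Z = pres_class R w" by (auto simp: carrier)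
  show "X \<otimes>\<^bsub>presented_group R\<^esub> Y \<otimes>\<^bsub>presented_group R\<^esub> Z =
      X \<otimes>\<^bsub>presented_group R\<^esub> (Y \<otimes>\<^bsub>presented_group R\<^esub> Z)"
    by (simp add: X Y Z presented_group_mult)
qed

datatype heis_gen = GenA | GenB | GenC

definition heis_rels :: "nat \<Rightarrow> (heis_gen word \<times> heis_gen word) set" where
  "heis_rels p =
    (let a = gen_word GenA; b = gen_word GenB; c = gen_word GenC in
     {(word_pow a p, []), (word_pow b p, []), (word_pow c p, []),
      (word_comm a b, c), (word_comm c a, []), (word_comm c b, [])})"

definition heis_group :: "nat \<Rightarrow> heis_gen word set monoid" where
  "heis_group p = presented_group (heis_rels p)"

definition heis_a :: "nat \<Rightarrow> heis_gen word set" where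
  "heis_a p = pres_class (heis_rels p) (gen_word GenA)"

definition heis_b :: "nat \<Rightarrow> heis_gen word set" where
  "heis_b p = pres_class (heis_rels p) (gen_word GenB)"

section \<open>Graphs, automorphisms and 3-arcs\<close>

record 'v ugraph =
  vertices :: "'v set"
  edges :: "'v set set"

definition Cos :: "('g, 'm) monoid_scheme \<Rightarrow> 'g set \<Rightarrow> 'g set \<Rightarrow> 'g set ugraph" where
  "Cos G H K =
    \<lparr>vertices = (rcosets\<^bsub>G\<^esub> H) \<union> (rcosets\<^bsub>G\<^esub> K),
     edges = {{H #>\<^bsub>G\<^esub> g, K #>\<^bsub>G\<^esub> h} | g h.
       g \<in> carrier G \<and> h \<in> carrier G \<and> (H #>\<^bsub>G\<^esub> g) \<inter> (K #>\<^bsub>G\<^esub> h) \<noteq> {}}\<rparr>"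

definition graph_auts :: "'v ugraph \<Rightarrow> ('v \<Rightarrow> 'v) set" where
  "graph_auts S =
    {f \<in> Bij (vertices S). \<forall>u\<in>vertices S. \<forall>v\<in>vertices S.
       {u, v} \<in> edges S \<longleftrightarrow> {f u, f v} \<in> edges S}"

definition AutGraph :: "'v ugraph \<Rightarrow> ('v \<Rightarrow> 'v) monoid" where
  "AutGraph S = BijGroup (vertices S) \<lparr>carrier := graph_auts S\<rparr>"

definition three_arcs :: "'v ugraph \<Rightarrow> 'v list set" where
  "three_arcs S =
    {vs. length vs = 4 \<and> set vs \<subseteq> vertices S \<and>
         (\<forall>i\<in>{1..3}. {vs ! (i - 1), vs ! i} \<in> edges S) \<and>
         (\<forall>i\<in>{1..2}. vs ! (i - 1) \<noteq> vs ! (i + 1))}"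

text \<open>
  The restriction is needed because \<^const>\<open>group_action\<close> asks for extensional permutations.
\<close>

definition three_arc_action :: "'v ugraph \<Rightarrow> ('v \<Rightarrow> 'v) \<Rightarrow> 'v list \<Rightarrow> 'v list" where
  "three_arc_action S f = (\<lambda>vs\<in>three_arcs S. map f vs)"

definition regular_action ::
    "('g, 'm) monoid_scheme \<Rightarrow> 'e set \<Rightarrow> ('g \<Rightarrow> 'e \<Rightarrow> 'e) \<Rightarrow> bool" where
  "regular_action G E \<phi> \<longleftrightarrow>
    transitive_action G E \<phi> \<and> (\<forall>x\<in>E. stabilizer G \<phi> x = {\<one>\<^bsub>G\<^esub>})"

definition three_arc_regular :: "'v ugraph \<Rightarrow> bool" where
  "three_arc_regular S \<longleftrightarrow> regular_action (AutGraph S) (three_arcs S) (three_arc_action S)"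

end

theory Submission
  imports Defs "HOL-Number_Theory.Cong"
begin

text \<open>Writing the elements of the group as \<open>a\<^sup>i b\<^sup>j c\<^sup>k\<close>, the coset \<open>\<langle>a\<rangle> b\<^sup>x c\<^sup>-\<^sup>y\<close> becomes the point
  \<open>(x, y)\<close> of the affine plane over the field with \<open>p\<close> elements and the coset \<open>\<langle>b\<rangle> a\<^sup>m c\<^sup>k\<close> the line
  \<open>y = m x - k\<close>: the graph is the incidence graph of the affine plane without the vertical lines.
  Explicit affine maps together with a point-line duality carry one fixed 3-arc to any other.
  An automorphism fixing that 3-arc preserves both the vertical classes of points and the
  parallel classes of lines, so in coordinates it is given by an additive map of the prime field
  fixing 1, which is the identity.\<close>

section \<open>The action of graph automorphisms on 3-arcs\<close>

lemma three_arcs_iff: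
  "vs \<in> three_arcs S \<longleftrightarrow> (\<exists>a b c d. vs = [a, b, c, d] \<and> {a, b, c, d} \<subseteq> vertices S \<and>
     {a, b} \<in> edges S \<and> {b, c} \<in> edges S \<and> {c, d} \<in> edges S \<and> a \<noteq> c \<and> b \<noteq> d)"
proof (cases "length vs = 4")
  case True
  then obtain a b c d where vs: "vs = [a, b, c, d]"
    by (auto simp: numeral_eq_Suc length_Suc_conv)
  have "{1..3} = {1, 2, 3::nat}" "{1..2} = {1, 2::nat}" by auto
  then show ?thesis by (simp add: three_arcs_def vs)
next
  case False
  then show ?thesis by (auto simp: three_arcs_def)
qed

lemma graph_autsD:
  assumes "f \<in> graph_auts S"
  shows "bij_betw f (vertices S) (vertices S)"
    and "u \<in> vertices S \<Longrightarrow> f u \<in> vertices S"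
    and "u \<in> vertices S \<Longrightarrow> v \<in> vertices S \<Longrightarrow> f u = f v \<longleftrightarrow> u = v"
    and "u \<in> vertices S \<Longrightarrow> v \<in> vertices S \<Longrightarrow> {f u, f v} \<in> edges S \<longleftrightarrow> {u, v} \<in> edges S"
proof -
  show *: "bij_betw f (vertices S) (vertices S)"
    using assms by (simp add: graph_auts_def Bij_def)
  show "u \<in> vertices S \<Longrightarrow> f u \<in> vertices S"
    using * by (rule bij_betwE[rule_format])
  show "u \<in> vertices S \<Longrightarrow> v \<in> vertices S \<Longrightarrow> f u = f v \<longleftrightarrow> u = v"
    using * by (meson bij_betw_def inj_on_eq_iff)
  show "u \<in> vertices S \<Longrightarrow> v \<in> vertices S \<Longrightarrow> {f u, f v} \<in> edges S \<longleftrightarrow> {u, v} \<in> edges S"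
    using assms by (simp add: graph_auts_def)
qed

lemma subgroup_graph_auts: "subgroup (graph_auts S) (BijGroup (vertices S))"
proof (rule group.subgroupI[OF group_BijGroup])
  show "graph_auts S \<subseteq> carrier (BijGroup (vertices S))"
    by (auto simp: graph_auts_def BijGroup_def)
  have "(\<lambda>v\<in>vertices S. v) \<in> graph_auts S"
    by (simp add: graph_auts_def id_Bij)
  then show "graph_auts S \<noteq> {}" by blast
next
  fix f assume f: "f \<in> graph_auts S"
  then have B: "f \<in> Bij (vertices S)" by (simp add: graph_auts_def)
  have im: "f ` vertices S = vertices S"
    using graph_autsD(1)[OF f] by (simp add: bij_betw_def)
  have "{u, v} \<in> edges S \<longleftrightarrow> {inv_into (vertices S) f u, inv_into (vertices S) f v} \<in> edges S"
    if "u \<in> vertices S" "v \<in> vertices S" for u v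
    using graph_autsD(4)[OF f Bij_inv_into_mem[OF B that(1)] Bij_inv_into_mem[OF B that(2)]] that im
    by (simp add: f_inv_into_f)
  then show "inv\<^bsub>BijGroup (vertices S)\<^esub> f \<in> graph_auts S"
    by (simp add: inv_BijGroup[OF B] graph_auts_def restrict_inv_into_Bij[OF B])
next
  fix f g assume fg: "f \<in> graph_auts S" "g \<in> graph_auts S"
  then have "f \<in> Bij (vertices S)" "g \<in> Bij (vertices S)" by (simp_all add: graph_auts_def)
  then show "f \<otimes>\<^bsub>BijGroup (vertices S)\<^esub> g \<in> graph_auts S"
    using graph_autsD(2,4)[OF fg(1)] graph_autsD(2,4)[OF fg(2)]
    by (simp add: BijGroup_def graph_auts_def compose_Bij compose_eq)
qed

lemma group_AutGraph: "group (AutGraph S)"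
  unfolding AutGraph_def
  by (rule subgroup.subgroup_is_group[OF subgroup_graph_auts group_BijGroup])

lemma AutGraph_simps [simp]:
  "carrier (AutGraph S) = graph_auts S"
  "\<one>\<^bsub>AutGraph S\<^esub> = (\<lambda>v\<in>vertices S. v)"
  by (simp_all add: AutGraph_def BijGroup_def)

lemma mult_AutGraph:
  "f \<in> graph_auts S \<Longrightarrow> g \<in> graph_auts S \<Longrightarrow> f \<otimes>\<^bsub>AutGraph S\<^esub> g = compose (vertices S) f g"
  by (simp add: AutGraph_def BijGroup_def graph_auts_def)

lemma map_three_arcs:
  assumes "f \<in> graph_auts S" "vs \<in> three_arcs S"
  shows "map f vs \<in> three_arcs S"
proof -
  obtain a b c d where "vs = [a, b, c, d]" "{a, b, c, d} \<subseteq> vertices S"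
     "{a, b} \<in> edges S" "{b, c} \<in> edges S" "{c, d} \<in> edges S" "a \<noteq> c" "b \<noteq> d"
    using assms(2) by (auto simp: three_arcs_iff)
  then show ?thesis
    by (simp add: three_arcs_iff graph_autsD[OF assms(1)])
qed

lemma three_arcs_subset: "vs \<in> three_arcs S \<Longrightarrow> set vs \<subseteq> vertices S"
  by (simp add: three_arcs_def)

lemma three_arc_action_mult:
  assumes "f \<in> graph_auts S" "g \<in> graph_auts S"
  shows "three_arc_action S (f \<otimes>\<^bsub>AutGraph S\<^esub> g) =
    compose (three_arcs S) (three_arc_action S f) (three_arc_action S g)"
proof
  fix vs
  show "three_arc_action S (f \<otimes>\<^bsub>AutGraph S\<^esub> g) vs =
    compose (three_arcs S) (three_arc_action S f) (three_arc_action S g) vs"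
  proof (cases "vs \<in> three_arcs S")
    case True
    then show ?thesis
      using three_arcs_subset[OF True] map_three_arcs[OF assms(2) True]
      by (auto simp: three_arc_action_def mult_AutGraph assms compose_eq)
  qed (simp add: three_arc_action_def compose_def)
qed

lemma three_arc_action_one:
  "three_arc_action S \<one>\<^bsub>AutGraph S\<^esub> = (\<lambda>vs\<in>three_arcs S. vs)"
  using three_arcs_subset
  by (fastforce simp: three_arc_action_def intro!: restrict_ext map_idI)

lemma three_arc_group_action:
  "group_action (AutGraph S) (three_arcs S) (three_arc_action S)"
proof -
  interpret group "AutGraph S" by (rule group_AutGraph)
  have Bij: "three_arc_action S f \<in> Bij (three_arcs S)" if f: "f \<in> graph_auts S" for f
  proof -
    have g: "inv\<^bsub>AutGraph S\<^esub> f \<in> graph_auts S" (is "?g \<in> _")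
      using f inv_closed by simp
    \<comment> \<open>Both composites with the action of the group inverse are the identity on
      3-arcs because the action is multiplicative. So that action is the two-sided inverse that
      witnesses bijectivity.\<close>
    have "compose (three_arcs S) (three_arc_action S ?g) (three_arc_action S f) = (\<lambda>vs\<in>three_arcs S. vs)"
         "compose (three_arcs S) (three_arc_action S f) (three_arc_action S ?g) = (\<lambda>vs\<in>three_arcs S. vs)"
      using f g l_inv r_inv by (simp_all flip: three_arc_action_mult three_arc_action_one)
    then have *: "three_arc_action S ?g (three_arc_action S f vs) = vs"
      "three_arc_action S f (three_arc_action S ?g vs) = vs" if "vs \<in> three_arcs S" for vs
      using that by (metis compose_eq restrict_apply')+
    have "bij_betw (three_arc_action S f) (three_arcs S) (three_arcs S)"
      by (rule bij_betw_byWitness[where f' = "three_arc_action S ?g"])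
        (use * map_three_arcs[OF f] map_three_arcs[OF g] in \<open>auto simp: three_arc_action_def\<close>)
    then show ?thesis by (simp add: Bij_def three_arc_action_def)
  qed
  show ?thesis
    unfolding group_action_def group_hom_def group_hom_axioms_def hom_def
    using Bij by (auto simp: group_BijGroup group_AutGraph three_arc_action_mult)
      (simp_all add: BijGroup_def)
qed

text \<open>One base arc decides everything: any two arcs are linked through it, and the stabilizer
  of an arc is conjugate to the stabilizer of the base arc. The latter is trivial once it is known
  to fix every vertex.\<close>

lemma three_arc_regularI:
  assumes v0: "vs0 \<in> three_arcs S"
    and reach: "\<And>vs. vs \<in> three_arcs S \<Longrightarrow> \<exists>f\<in>graph_auts S. map f vs0 = vs"
    and rigid: "\<And>f v. f \<in> graph_auts S \<Longrightarrow> map f vs0 = vs0 \<Longrightarrow> v \<in> vertices S \<Longrightarrow> f v = v"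
  shows "three_arc_regular S"
proof -
  interpret group "AutGraph S" by (rule group_AutGraph)
  interpret group_action "AutGraph S" "three_arcs S" "three_arc_action S"
    by (rule three_arc_group_action)
  have act: "three_arc_action S f vs = map f vs" if "vs \<in> three_arcs S" for f vs
    using that by (simp add: three_arc_action_def)
  have trans: "\<exists>g\<in>graph_auts S. three_arc_action S g x = y"
    if x: "x \<in> three_arcs S" and y: "y \<in> three_arcs S" for x y
  proof -
    obtain f where f: "f \<in> graph_auts S" "map f vs0 = x" using reach[OF x] by blast
    obtain g where g: "g \<in> graph_auts S" "map g vs0 = y" using reach[OF y] by blast
    have "three_arc_action S (inv\<^bsub>AutGraph S\<^esub> f) x = vs0"
      using orbit_sym_aux[of f vs0 x] f v0 by (simp add: act)
    then have "three_arc_action S (g \<otimes>\<^bsub>AutGraph S\<^esub> inv\<^bsub>AutGraph S\<^esub> f) x = y"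
      using composition_rule[of x g "inv\<^bsub>AutGraph S\<^esub> f"] f g x v0 inv_closed[of f] by (simp add: act)
    then show ?thesis using f g m_closed[of g "inv\<^bsub>AutGraph S\<^esub> f"] inv_closed[of f] by auto
  qed
  moreover have "stabilizer (AutGraph S) (three_arc_action S) x = {\<one>\<^bsub>AutGraph S\<^esub>}"
    if x: "x \<in> three_arcs S" for x
  proof -
    have "g = \<one>\<^bsub>AutGraph S\<^esub>" if g: "g \<in> graph_auts S" "three_arc_action S g x = x" for g
    proof -
      obtain f where f: "f \<in> graph_auts S" "map f vs0 = x" using reach[OF x] by blast
      have "g (f v) = f v" if v: "v \<in> vertices S" for v
      proof -
        \<comment> \<open>The conjugate of \<open>g\<close> by \<open>f\<close> fixes the base arc,
          hence every vertex \<open>v\<close>; evaluating \<open>f ?h = g f\<close> at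
          \<open>v\<close> then shows that \<open>g\<close> fixes \<open>f v\<close>.\<close>
        let ?h = "inv\<^bsub>AutGraph S\<^esub> f \<otimes>\<^bsub>AutGraph S\<^esub> (g \<otimes>\<^bsub>AutGraph S\<^esub> f)"
        have h: "?h \<in> graph_auts S" using f g m_closed inv_closed by simp
        have "three_arc_action S (inv\<^bsub>AutGraph S\<^esub> f) x = vs0"
          using orbit_sym_aux[of f vs0 x] f v0 by (simp add: act)
        then have "three_arc_action S ?h vs0 = vs0"
          using composition_rule[of vs0 g f] composition_rule[of vs0 "inv\<^bsub>AutGraph S\<^esub> f" "g \<otimes>\<^bsub>AutGraph S\<^esub> f"]
            f g v0 inv_closed[of f] m_closed[of g f] by (simp add: act[OF v0])
        then have "?h v = v" using rigid[OF h] v by (simp add: act[OF v0])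
        moreover have "f \<otimes>\<^bsub>AutGraph S\<^esub> ?h = g \<otimes>\<^bsub>AutGraph S\<^esub> f"
          using f g inv_closed[of f] m_closed[of g f] m_assoc[of f "inv\<^bsub>AutGraph S\<^esub> f" "g \<otimes>\<^bsub>AutGraph S\<^esub> f"]
            r_inv[of f] l_one[of "g \<otimes>\<^bsub>AutGraph S\<^esub> f"] by (simp del: AutGraph_simps(2))
        ultimately show ?thesis
          using mult_AutGraph[OF f(1) h] mult_AutGraph[OF g(1) f(1)] v by (metis compose_eq)
      qed
      \<comment> \<open>As \<open>f\<close> is onto, \<open>g\<close> fixes all vertices;
        extensionality settles its values elsewhere, so \<open>g\<close> equals the restricted
        identity.\<close>
      moreover have "f ` vertices S = vertices S"
        using graph_autsD(1)[OF f(1)] by (simp add: bij_betw_def)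
      ultimately have "\<forall>v\<in>vertices S. g v = v" by (metis imageE)
      moreover have "g \<in> extensional (vertices S)" using g by (simp add: graph_auts_def Bij_def)
      ultimately show ?thesis by (auto simp: extensional_def fun_eq_iff)
    qed
    moreover have "three_arc_action S \<one>\<^bsub>AutGraph S\<^esub> x = x"
      unfolding three_arc_action_one using x by simp
    ultimately show ?thesis
      unfolding stabilizer_def AutGraph_simps(1) using one_closed[unfolded AutGraph_simps(1)] by blast
  qed
  ultimately show ?thesis
    unfolding three_arc_regular_def regular_action_def transitive_action_def transitive_action_axioms_def
    using group_action_axioms by simp
qed

section \<open>The biaffine plane\<close>

lemma cong_linear_solvable:
  fixes p :: int
  assumes "prime p" "\<not> [u = 0] (mod p)"
  obtains m where "[m * u = v] (mod p)"
proof -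
  have "coprime u p"
    using assms prime_imp_coprime[of p u] by (simp add: cong_0_iff coprime_commute)
  then obtain w where "[u * w = 1] (mod p)" using cong_solve_coprime_int by blast
  then have "[(u * w) * v = 1 * v] (mod p)" by (rule cong_scalar_right)
  then have "[(v * w) * u = v] (mod p)" by (simp add: ac_simps)
  then show ?thesis using that by blast
qed

text \<open>The incidence graph of the affine plane over the field with \<open>p\<close> elements, without its
  vertical lines; coordinates are integers read modulo \<open>p\<close>. The line \<open>L m k\<close> is the graph of
  \<open>x \<mapsto> m * x - k\<close>, the sign being chosen so that exchanging \<open>P\<close> and \<open>L\<close> is a duality.\<close>

locale biaffine_graph =
  fixes p :: int and S :: "'v ugraph" and P L :: "int \<Rightarrow> int \<Rightarrow> 'v"
  assumes prime_p: "prime p"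
    and P_eq_iff: "P x y = P x' y' \<longleftrightarrow> [x = x'] (mod p) \<and> [y = y'] (mod p)"
    and L_eq_iff: "L m k = L m' k' \<longleftrightarrow> [m = m'] (mod p) \<and> [k = k'] (mod p)"
    and P_neq_L: "P x y \<noteq> L m k"
    and vertices_eq: "vertices S = {P x y | x y. True} \<union> {L m k | m k. True}"
    and edges_eq: "edges S = {{P x y, L m k} | x y m k. [y + k = m * x] (mod p)}"
begin

text \<open>The incidence equation \<open>y + k = m * x\<close> is symmetric under exchanging
  \<open>x\<close> with \<open>m\<close> and \<open>y\<close> with \<open>k\<close>. Hence every
  fact of the locale can be reused with points and lines interchanged.\<close>

lemma dual: "biaffine_graph p S L P"
proof
  show "vertices S = {L x y | x y. True} \<union> {P m k | m k. True}"
    by (auto simp: vertices_eq)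
  show "edges S = {{L x y, P m k} | x y m k. [y + k = m * x] (mod p)}"
    unfolding edges_eq by (auto simp: insert_commute ac_simps; metis insert_commute mult.commute add.commute)
qed (use prime_p P_eq_iff L_eq_iff P_neq_L in \<open>auto simp: eq_commute\<close>)

lemma P_vertex [simp]: "P x y \<in> vertices S" and L_vertex [simp]: "L m k \<in> vertices S"
  by (auto simp: vertices_eq)

lemma L_neq_P: "L m k \<noteq> P x y"
  using P_neq_L by metis

text \<open>An edge is an unordered pair given by some representatives. Disjointness of points and
  lines tells which member is the point, and the incidence equation survives a change of coordinates
  modulo \<open>p\<close>.\<close>

lemma adjacent_PL: "{P x y, L m k} \<in> edges S \<longleftrightarrow> [y + k = m * x] (mod p)"
proof
  assume "{P x y, L m k} \<in> edges S"
  then obtain x' y' m' k' where *: "{P x y, L m k} = {P x' y', L m' k'}" "[y' + k' = m' * x'] (mod p)"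
    by (auto simp: edges_eq)
  then have "P x y = P x' y'" "L m k = L m' k'"
    using P_neq_L by (auto simp: doubleton_eq_iff)
  then have c: "[x = x'] (mod p)" "[y = y'] (mod p)" "[m = m'] (mod p)" "[k = k'] (mod p)"
    by (simp_all add: P_eq_iff L_eq_iff)
  have "[y + k = y' + k'] (mod p)" "[m * x = m' * x'] (mod p)"
    using c by (auto intro: cong_add cong_mult)
  then show "[y + k = m * x] (mod p)"
    using *(2) by (metis cong_sym cong_trans)
qed (auto simp: edges_eq)

lemma adjacent_LP: "{L m k, P x y} \<in> edges S \<longleftrightarrow> [y + k = m * x] (mod p)"
  using adjacent_PL by (simp add: insert_commute)

lemma not_adjacent_PP: "{P x y, P x' y'} \<notin> edges S"
  using P_neq_L by (auto simp: edges_eq doubleton_eq_iff)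

lemma not_adjacent_LL: "{L x y, L x' y'} \<notin> edges S"
  using P_neq_L L_neq_P by (auto simp: edges_eq doubleton_eq_iff)

lemmas adjacent_simps = adjacent_PL adjacent_LP not_adjacent_PP not_adjacent_LL

lemma vertex_cases:
  assumes "v \<in> vertices S"
  obtains x y where "v = P x y" | m k where "v = L m k"
  using assms by (auto simp: vertices_eq)

lemma neighbour_P: "{P x y, v} \<in> edges S \<Longrightarrow> v \<in> vertices S \<Longrightarrow> \<exists>m k. v = L m k"
  by (erule vertex_cases) (auto simp: not_adjacent_PP)

lemma neighbour_L: "{L m k, v} \<in> edges S \<Longrightarrow> v \<in> vertices S \<Longrightarrow> \<exists>x y. v = P x y"
  by (erule vertex_cases) (auto simp: not_adjacent_LL)

section \<open>Automorphisms given by coordinate maps\<close>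

lemma finite_vertices: "finite (vertices S)"
proof -
  have p: "p > 0" using prime_p prime_gt_0_int by blast
  have "vertices S \<subseteq> case_prod P ` ({0..<p} \<times> {0..<p}) \<union> case_prod L ` ({0..<p} \<times> {0..<p})"
  proof
    fix v assume "v \<in> vertices S"
    then show "v \<in> case_prod P ` ({0..<p} \<times> {0..<p}) \<union> case_prod L ` ({0..<p} \<times> {0..<p})"
    proof (cases rule: vertex_cases)
      case (1 x y)
      have "v = case_prod P (x mod p, y mod p)" by (simp add: 1 P_eq_iff cong_def)
      then show ?thesis using p by force
    next
      case (2 x y)
      have "v = case_prod L (x mod p, y mod p)" by (simp add: 2 L_eq_iff cong_def)
      then show ?thesis using p by force
    qed
  qed
  then show ?thesis by (rule finite_subset) auto
qed

text \<open>Each equivalence in \<open>P_eq\<close> and \<open>L_eq\<close> is used in both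
  directions: one makes the map well defined on vertices, the other makes it injective. Surjectivity
  then follows from finiteness of the vertex set.\<close>

lemma automorphism_exists:
  assumes P_eq: "\<And>x y x' y'. fP x y = fP x' y' \<longleftrightarrow> P x y = P x' y'"
    and L_eq: "\<And>m k m' k'. fL m k = fL m' k' \<longleftrightarrow> L m k = L m' k'"
    and neq: "\<And>x y m k. fP x y \<noteq> fL m k"
    and V: "\<And>x y. fP x y \<in> vertices S" "\<And>m k. fL m k \<in> vertices S"
    and adj: "\<And>x y m k. {fP x y, fL m k} \<in> edges S \<longleftrightarrow> {P x y, L m k} \<in> edges S"
    and nadj: "\<And>x y x' y'. {fP x y, fP x' y'} \<notin> edges S" "\<And>m k m' k'. {fL m k, fL m' k'} \<notin> edges S"
  obtains f where "f \<in> graph_auts S" "\<And>x y. f (P x y) = fP x y" "\<And>m k. f (L m k) = fL m k"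
proof -
  \<comment> \<open>A vertex has many coordinate pairs, congruent modulo \<open>p\<close>, so the
    value is given by a definite description; \<open>P_eq\<close> and \<open>L_eq\<close> supply its
    uniqueness. The restriction is needed for membership in \<open>Bij\<close>.\<close>
  define f where "f = (\<lambda>v\<in>vertices S.
    THE w. (\<exists>x y. v = P x y \<and> w = fP x y) \<or> (\<exists>m k. v = L m k \<and> w = fL m k))"
  have fP: "f (P x y) = fP x y" for x y
    unfolding f_def by (simp, rule the_equality) (auto simp: P_neq_L P_eq[symmetric])
  have fL: "f (L m k) = fL m k" for m k
    unfolding f_def by (simp, rule the_equality) (auto simp: L_neq_P L_eq[symmetric])
  have inj: "inj_on f (vertices S)"
  proof (rule inj_onI)
    fix u v assume uv: "u \<in> vertices S" "v \<in> vertices S" "f u = f v"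
    from uv(1) show "u = v"
    proof (cases rule: vertex_cases)
      case u: (1 x y)
      from uv(2) show ?thesis
        by (cases rule: vertex_cases) (use uv(3) neq in \<open>simp_all add: u fP fL P_eq\<close>)
    next
      case u: (2 m k)
      from uv(2) show ?thesis
        by (cases rule: vertex_cases) (use uv(3) neq[symmetric] in \<open>simp_all add: u fP fL L_eq\<close>)
    qed
  qed
  have "f ` vertices S \<subseteq> vertices S"
    using V by (force elim: vertex_cases simp: fP fL)
  then have "f ` vertices S = vertices S"
    using endo_inj_surj[OF finite_vertices _ inj] by blast
  then have "f \<in> Bij (vertices S)"
    using inj by (simp add: Bij_def bij_betw_def f_def)
  moreover have "{u, v} \<in> edges S \<longleftrightarrow> {f u, f v} \<in> edges S" if "u \<in> vertices S" "v \<in> vertices S" for u v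
    using that(1)
  proof (cases rule: vertex_cases)
    case u: (1 x y)
    from that(2) show ?thesis
      by (cases rule: vertex_cases) (simp_all add: u fP fL adj nadj not_adjacent_PP)
  next
    case u: (2 m k)
    from that(2) show ?thesis
      by (cases rule: vertex_cases)
        (simp_all add: u fP fL adj nadj not_adjacent_LL insert_commute[of "L m k"] insert_commute[of "fL m k"])
  qed
  ultimately have "f \<in> graph_auts S" by (simp add: graph_auts_def)
  then show ?thesis using that fP fL by blast
qed

lemma dual_automorphism:
  obtains f where "f \<in> graph_auts S" "\<And>x y. f (P x y) = L x y" "\<And>m k. f (L m k) = P m k"
proof (rule automorphism_exists[of L P])
qed (auto simp: P_eq_iff L_eq_iff L_neq_P adjacent_simps ac_simps)

text \<open>The flag \<open>P 0 0\<close>, \<open>L 0 0\<close> goes to the flag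
  \<open>P x1 y1\<close>, \<open>L m0 k0\<close>, while \<open>r\<close> scales first coordinates
  and \<open>s\<close> scales slopes. Incidence is preserved because the defect
  \<open>y + k - m * x\<close> of the images is \<open>s * r\<close> times the old defect plus the
  defect of the target flag, which vanishes modulo \<open>p\<close>.\<close>

lemma affine_automorphism:
  assumes flag: "[y1 + k0 = m0 * x1] (mod p)"
    and r: "\<not> [r = 0] (mod p)" and s: "\<not> [s = 0] (mod p)"
  obtains f where "f \<in> graph_auts S"
    "\<And>x y. f (P x y) = P (x1 + r * x) (y1 + m0 * r * x + s * r * y)"
    "\<And>m k. f (L m k) = L (m0 + s * m) (k0 + s * x1 * m + s * r * k)"
proof (rule automorphism_exists[of "\<lambda>x y. P (x1 + r * x) (y1 + m0 * r * x + s * r * y)"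
      "\<lambda>m k. L (m0 + s * m) (k0 + s * x1 * m + s * r * k)"])
  have dvd_r: "p dvd r * t \<longleftrightarrow> p dvd t" and dvd_s: "p dvd s * t \<longleftrightarrow> p dvd t" for t
    using r s prime_p by (simp_all add: cong_0_iff prime_dvd_mult_iff)
  \<comment> \<open>Points and lines are both transformed by a triangular map. Its diagonal entries
    \<open>t\<close> and \<open>d\<close> are invertible modulo \<open>p\<close>, and the shear term
    cancels once the first coordinates agree.\<close>
  have aux: "[a0 + t * x = a0 + t * x'] (mod p) \<and> [b0 + c * t * x + d * y = b0 + c * t * x' + d * y'] (mod p)
      \<longleftrightarrow> [x = x'] (mod p) \<and> [y = y'] (mod p)"
    if "\<And>z. p dvd t * z \<longleftrightarrow> p dvd z" "\<And>z. p dvd d * z \<longleftrightarrow> p dvd z" for a0 b0 c d t x x' y y'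
  proof -
    have 1: "[a0 + t * x = a0 + t * x'] (mod p) \<longleftrightarrow> [x = x'] (mod p)"
      using that(1)[of "x - x'"] by (simp add: cong_iff_dvd_diff algebra_simps)
    have "[b0 + c * t * x + d * y = b0 + c * t * x' + d * y'] (mod p) \<longleftrightarrow> [y = y'] (mod p)"
      if "[x = x'] (mod p)"
    proof -
      have "p dvd c * t * (x - x')" using that by (simp add: cong_iff_dvd_diff)
      then have "p dvd c * t * (x - x') + d * (y - y') \<longleftrightarrow> p dvd d * (y - y')"
        by (rule dvd_add_right_iff)
      then show ?thesis using \<open>\<And>z. p dvd d * z \<longleftrightarrow> p dvd z\<close>[of "y - y'"]
        by (simp add: cong_iff_dvd_diff algebra_simps)
    qed
    with 1 show ?thesis by blast
  qed
  have dvd_sr: "p dvd s * r * t \<longleftrightarrow> p dvd t" for t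
    using dvd_r dvd_s by (simp add: mult.assoc)
  show "P (x1 + r * x) (y1 + m0 * r * x + s * r * y) = P (x1 + r * x') (y1 + m0 * r * x' + s * r * y')
      \<longleftrightarrow> P x y = P x' y'" for x y x' y'
    unfolding P_eq_iff by (rule aux[OF dvd_r dvd_sr])
  show "L (m0 + s * m) (k0 + s * x1 * m + s * r * k) = L (m0 + s * m') (k0 + s * x1 * m' + s * r * k')
      \<longleftrightarrow> L m k = L m' k'" for m k m' k'
    unfolding L_eq_iff using aux[OF dvd_s dvd_sr, of m0 m m' k0 x1 k k'] by (simp add: ac_simps)
  show "{P (x1 + r * x) (y1 + m0 * r * x + s * r * y), L (m0 + s * m) (k0 + s * x1 * m + s * r * k)}
      \<in> edges S \<longleftrightarrow> {P x y, L m k} \<in> edges S" for x y m k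
  proof -
    have "y1 + m0 * r * x + s * r * y + (k0 + s * x1 * m + s * r * k) - (m0 + s * m) * (x1 + r * x)
       = (y1 + k0 - m0 * x1) + s * r * (y + k - m * x)"
      by (simp add: algebra_simps)
    moreover have "p dvd y1 + k0 - m0 * x1" using flag by (simp add: cong_iff_dvd_diff)
    ultimately show ?thesis
      unfolding adjacent_PL cong_iff_dvd_diff by (simp only: dvd_add_right_iff dvd_sr)
  qed
qed (simp_all add: P_neq_L not_adjacent_PP not_adjacent_LL)

section \<open>Transitivity on 3-arcs\<close>

text \<open>The lines \<open>y = 0\<close> and \<open>y = x\<close> through the origin, followed by
  the point \<open>(1, 1)\<close> on the second line.\<close>

definition base_arc :: "'v list" where
  "base_arc = [L 0 0, P 0 0, L 1 0, P 1 1]"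

lemma not_cong_one_zero: "\<not> [1 = 0] (mod p)"
  using prime_p by (auto simp: cong_0_iff)

lemma base_arc_in: "base_arc \<in> three_arcs S"
  using not_cong_one_zero cong_sym[of 0 1 p]
  by (auto simp: base_arc_def three_arcs_iff adjacent_simps P_eq_iff L_eq_iff)

text \<open>Send the initial flag of the base arc to that of the given arc, with
  \<open>r = x3 - x1\<close> and \<open>s = m2 - m0\<close>. This matches the slope of the second
  line and the first coordinate of the last point; incidence forces the two remaining
  coordinates.\<close>

lemma line_arc_reachable:
  assumes "[L m0 k0, P x1 y1, L m2 k2, P x3 y3] \<in> three_arcs S"
  shows "\<exists>f\<in>graph_auts S. map f base_arc = [L m0 k0, P x1 y1, L m2 k2, P x3 y3]"
proof -
  have adj: "[y1 + k0 = m0 * x1] (mod p)" "[y1 + k2 = m2 * x1] (mod p)" "[y3 + k2 = m2 * x3] (mod p)"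
    and neq: "L m0 k0 \<noteq> L m2 k2" "P x1 y1 \<noteq> P x3 y3"
    using assms by (auto simp: three_arcs_iff adjacent_simps)
  have d: "p dvd y1 + k0 - m0 * x1" "p dvd y1 + k2 - m2 * x1" "p dvd y3 + k2 - m2 * x3"
    using adj by (simp_all add: cong_iff_dvd_diff)
  \<comment> \<open>Distinct points on a common line differ in their first coordinate, as no line is
    vertical.\<close>
  have r: "\<not> [x3 - x1 = 0] (mod p)"
  proof
    assume "[x3 - x1 = 0] (mod p)"
    then have x: "p dvd x3 - x1" by (simp add: cong_0_iff)
    have "y3 - y1 = (y3 + k2 - m2 * x3) - (y1 + k2 - m2 * x1) + m2 * (x3 - x1)"
      by (simp add: algebra_simps)
    then have "p dvd y3 - y1" using d x by (metis dvd_add dvd_diff dvd_mult)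
    then show False using x neq(2) by (simp add: P_eq_iff cong_iff_dvd_diff dvd_diff_commute)
  qed
  \<comment> \<open>Distinct lines through a common point have different slopes.\<close>
  have s: "\<not> [m2 - m0 = 0] (mod p)"
  proof
    assume "[m2 - m0 = 0] (mod p)"
    then have x: "p dvd m2 - m0" by (simp add: cong_0_iff)
    have "k2 - k0 = (y1 + k2 - m2 * x1) - (y1 + k0 - m0 * x1) + x1 * (m2 - m0)"
      by (simp add: algebra_simps)
    then have "p dvd k2 - k0" using d x by (metis dvd_add dvd_diff dvd_mult)
    then show False using x neq(1) by (simp add: L_eq_iff cong_iff_dvd_diff dvd_diff_commute)
  qed
  obtain f where f: "f \<in> graph_auts S"
    "\<And>x y. f (P x y) = P (x1 + (x3 - x1) * x) (y1 + m0 * (x3 - x1) * x + (m2 - m0) * (x3 - x1) * y)"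
    "\<And>m k. f (L m k) = L (m0 + (m2 - m0) * m) (k0 + (m2 - m0) * x1 * m + (m2 - m0) * (x3 - x1) * k)"
    by (rule affine_automorphism[OF adj(1) r s]) blast
  have "k0 + (m2 - m0) * x1 - k2 = (y1 + k0 - m0 * x1) - (y1 + k2 - m2 * x1)"
    by (simp add: algebra_simps)
  then have k2: "p dvd k0 + (m2 - m0) * x1 - k2" using d by (metis dvd_diff)
  have "y1 + m0 * (x3 - x1) + (m2 - m0) * (x3 - x1) - y3 = (y1 + k2 - m2 * x1) - (y3 + k2 - m2 * x3)"
    by (simp add: algebra_simps)
  then have y3: "p dvd y1 + m0 * (x3 - x1) + (m2 - m0) * (x3 - x1) - y3" using d by (metis dvd_diff)
  have "map f base_arc = [L m0 k0, P x1 y1, L m2 k2, P x3 y3]"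
    using k2 y3 by (simp add: base_arc_def f P_eq_iff L_eq_iff cong_iff_dvd_diff)
  then show ?thesis using f(1) by (rule bexI)
qed

lemma arc_reachable:
  assumes vs: "vs \<in> three_arcs S"
  shows "\<exists>f\<in>graph_auts S. map f base_arc = vs"
proof -
  obtain a b c d where arc: "vs = [a, b, c, d]" "a \<in> vertices S" "b \<in> vertices S" "c \<in> vertices S"
     "d \<in> vertices S" "{a, b} \<in> edges S" "{b, c} \<in> edges S" "{c, d} \<in> edges S"
    using vs by (auto simp: three_arcs_iff)
  from arc(2) show ?thesis
  proof (cases rule: vertex_cases)
    case a: (2 m0 k0)
    obtain x1 y1 where b: "b = P x1 y1"
      using neighbour_L arc(3,6) a by blast
    obtain m2 k2 where c: "c = L m2 k2"
      using neighbour_P arc(4,7) b by blast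
    obtain x3 y3 where d: "d = P x3 y3"
      using neighbour_L arc(5,8) c by blast
    show ?thesis
      using line_arc_reachable[OF vs[unfolded arc(1) a b c d]] unfolding arc(1) a b c d .
  next
    case a: (1 m0 k0)
    obtain x1 y1 where b: "b = L x1 y1"
      using neighbour_P arc(3,6) a by blast
    obtain m2 k2 where c: "c = P m2 k2"
      using neighbour_L arc(4,7) b by blast
    obtain x3 y3 where d: "d = L x3 y3"
      using neighbour_P arc(5,8) c by blast
    \<comment> \<open>Duality turns an arc starting at a point into one starting at a line; since it
      swaps equal coordinates, applying \<open>g\<close> once more brings the image back.\<close>
    obtain g where g: "g \<in> graph_auts S" "\<And>x y. g (P x y) = L x y" "\<And>m k. g (L m k) = P m k"
      by (rule dual_automorphism) blast
    have "[L m0 k0, P x1 y1, L m2 k2, P x3 y3] \<in> three_arcs S"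
      using map_three_arcs[OF g(1) vs] by (simp add: arc(1) a b c d g)
    then obtain f where f: "f \<in> graph_auts S" "map f base_arc = [L m0 k0, P x1 y1, L m2 k2, P x3 y3]"
      using bexE[OF line_arc_reachable] by metis
    have "compose (vertices S) g f \<in> graph_auts S"
      using subgroup.m_closed[OF subgroup_graph_auts g(1) f(1)] f(1) g(1)
      by (simp add: BijGroup_def graph_auts_def)
    moreover have "map (compose (vertices S) g f) base_arc = map g (map f base_arc)"
      by (simp add: base_arc_def compose_eq)
    moreover have "map g (map f base_arc) = vs"
      unfolding f(2) by (simp add: arc(1) a b c d g)
    ultimately show ?thesis by metis
  qed
qed

section \<open>Rigidity: automorphisms fixing the base arc\<close>

text \<open>Two distinct points have no common neighbour iff their first coordinates agree, so
  automorphisms preserve the parallel classes.\<close>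

lemma parallel_classes_preserved:
  assumes f: "f \<in> graph_auts S"
    and fP: "\<And>x y. \<exists>x' y'. f (P x y) = P x' y'"
  obtains \<phi> F where "\<And>x y. f (P x y) = P (\<phi> x) (F x y)"
proof -
  obtain \<psi> F where F: "\<And>x y. f (P x y) = P (\<psi> x y) (F x y)"
    using fP by metis
  have "[\<psi> x y = \<psi> x 0] (mod p)" for x y
  proof (rule ccontr)
    assume neq: "\<not> [\<psi> x y = \<psi> x 0] (mod p)"
    then have "\<not> [\<psi> x y - \<psi> x 0 = 0] (mod p)" by (simp add: cong_iff_dvd_diff)
    then obtain m where m: "[m * (\<psi> x y - \<psi> x 0) = F x y - F x 0] (mod p)"
      using cong_linear_solvable[OF prime_p] by blast
    \<comment> \<open>The line of slope \<open>m\<close> through \<open>f (P x 0)\<close>; by the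
      choice of \<open>m\<close> it also contains \<open>f (P x y)\<close>. Its preimage is a line
      joining two points of one vertical class, which forces them to coincide.\<close>
    define w where "w = L m (m * \<psi> x 0 - F x 0)"
    have "w \<in> f ` vertices S"
      using graph_autsD(1)[OF f] by (simp add: bij_betw_def w_def)
    then obtain v where v: "v \<in> vertices S" "f v = w" by blast
    then obtain m' k' where v': "v = L m' k'"
      using fP P_neq_L unfolding w_def by (metis vertex_cases)
    have "{f (P x 0), f v} \<in> edges S"
      unfolding v F w_def adjacent_PL by simp
    then have 1: "[k' = m' * x] (mod p)"
      using graph_autsD(4)[OF f _ v(1), of "P x 0"] by (simp add: v' adjacent_PL)
    have "[F x y + (m * \<psi> x 0 - F x 0) = m * \<psi> x y] (mod p)"
      using cong_sym[OF m] by (simp add: cong_iff_dvd_diff algebra_simps)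
    then have "{f (P x y), f v} \<in> edges S"
      unfolding v F w_def adjacent_PL .
    then have 2: "[y + k' = m' * x] (mod p)"
      using graph_autsD(4)[OF f _ v(1), of "P x y"] by (simp add: v' adjacent_PL)
    have "[y + k' = 0 + k'] (mod p)" using 2 cong_sym[OF 1] by (metis add_0 cong_trans)
    then have "[y = 0] (mod p)" using cong_add_rcancel by blast
    then have "P x y = P x 0" by (simp add: P_eq_iff)
    then have "P (\<psi> x y) (F x y) = P (\<psi> x 0) (F x 0)" by (metis F)
    then show False using neq by (simp add: P_eq_iff)
  qed
  then have "f (P x y) = P (\<psi> x 0) (F x y)" for x y
    by (simp add: F P_eq_iff)
  then show ?thesis using that[of "\<lambda>x. \<psi> x 0" F] by blast
qed

text \<open>Sides propagate along edges, and every vertex is reached from the origin: first the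
  lines \<open>L m 0\<close>, then the points \<open>P 1 y\<close> on \<open>L y 0\<close>, then any
  line \<open>L m k\<close> through \<open>P 1 (m - k)\<close>, and finally any point
  \<open>P x y\<close> on the horizontal line \<open>L 0 (- y)\<close>.\<close>

lemma automorphism_preserves_sides:
  assumes f: "f \<in> graph_auts S" and f0: "f (P 0 0) = P 0 0"
  shows "\<exists>x' y'. f (P x y) = P x' y'" and "\<exists>m' k'. f (L m k) = L m' k'"
proof -
  have V: "f v \<in> vertices S" if "v \<in> vertices S" for v
    using that by (rule graph_autsD(2)[OF f])
  have PL: "\<exists>m' k'. f (L m k) = L m' k'"
    if "[y + k = m * x] (mod p)" "\<exists>x' y'. f (P x y) = P x' y'" for x y m k
    using graph_autsD(4)[OF f, of "P x y" "L m k"] that V[of "L m k"]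
    by (metis P_vertex L_vertex adjacent_PL not_adjacent_PP vertex_cases)
  have LP: "\<exists>x' y'. f (P x y) = P x' y'"
    if "[y + k = m * x] (mod p)" "\<exists>m' k'. f (L m k) = L m' k'" for x y m k
    using graph_autsD(4)[OF f, of "P x y" "L m k"] that V[of "P x y"]
    by (metis P_vertex L_vertex adjacent_PL not_adjacent_LL vertex_cases)
  have L0: "\<exists>m' k'. f (L m 0) = L m' k'" for m
    using PL[of 0 0 m 0] f0 by auto
  have P1: "\<exists>x' y'. f (P 1 y) = P x' y'" for y
    using LP[OF _ L0[of y], of y 1] by auto
  have L: "\<exists>m' k'. f (L m k) = L m' k'" for m k
    using PL[OF _ P1[of "m - k"], of k m] by auto
  show "\<exists>m' k'. f (L m k) = L m' k'" by (rule L)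
  show "\<exists>x' y'. f (P x y) = P x' y'"
    using LP[OF _ L[of 0 "-y"], of y x] by auto
qed

text \<open>With \<open>f (P x y) = P (\<phi> x) (F x y)\<close> and \<open>f (L m k) = L (\<mu> m) (G m k)\<close>, incidence gives
  \<open>F x y + G m k = \<mu> m * \<phi> x\<close> whenever \<open>y + k = m * x\<close>. Taking \<open>x = 0\<close> and \<open>m = 0\<close> shows that
  \<open>F x y\<close> depends on \<open>y\<close> only, say \<open>F x y = h y\<close>, and \<open>G m k = - h (- k)\<close>; hence
  \<open>h y - h (y - m * x) = \<mu> m * \<phi> x\<close>. Now \<open>h = \<mu> = \<phi>\<close> is additive and fixes 1.\<close>

lemma rigid:
  assumes f: "f \<in> graph_auts S" and arc: "map f base_arc = base_arc" and v: "v \<in> vertices S"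
  shows "f v = v"
proof -
  have f0: "f (L 0 0) = L 0 0" "f (P 0 0) = P 0 0" "f (L 1 0) = L 1 0" "f (P 1 1) = P 1 1"
    using arc by (simp_all add: base_arc_def)
  note sides = automorphism_preserves_sides[OF f f0(2)]
  obtain \<phi> F where F: "\<And>x y. f (P x y) = P (\<phi> x) (F x y)"
    using parallel_classes_preserved[OF f sides(1)] by blast
  \<comment> \<open>The fact about vertical classes of points, read in the dual graph, describes
    parallel classes of lines.\<close>
  obtain \<mu> G where G: "\<And>m k. f (L m k) = L (\<mu> m) (G m k)"
    using biaffine_graph.parallel_classes_preserved[OF dual f sides(2)] by blast
  have inc: "[F x y + G m k = \<mu> m * \<phi> x] (mod p)" if "y + k = m * x" for x y m k
    using graph_autsD(4)[OF f, of "P x y" "L m k"] that by (simp add: F G adjacent_PL)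
  have base: "[\<mu> 0 = 0] (mod p)" "[G 0 0 = 0] (mod p)" "[\<phi> 0 = 0] (mod p)" "[F 0 0 = 0] (mod p)"
    "[\<mu> 1 = 1] (mod p)" "[\<phi> 1 = 1] (mod p)"
    using f0 by (simp_all add: F G P_eq_iff L_eq_iff)
  define h where "h = F 0"
  have G_h: "[G m k = - h (- k)] (mod p)" for m k
  proof -
    \<comment> \<open>The line \<open>L m k\<close> meets the column \<open>x = 0\<close> in
      \<open>P 0 (- k)\<close>, and \<open>\<phi> 0\<close> vanishes modulo
      \<open>p\<close>.\<close>
    have "[F 0 (- k) + G m k = 0] (mod p)"
      using inc[of "- k" k m 0] cong_scalar_left[OF base(3), of "\<mu> m"] by (auto intro: cong_trans)
    then show ?thesis by (simp add: h_def cong_iff_dvd_diff add.commute)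
  qed
  have F_h: "[F x y = h y] (mod p)" for x y
  proof -
    \<comment> \<open>The horizontal line \<open>L 0 (- y)\<close> contains \<open>P x y\<close> for
      all \<open>x\<close>, and \<open>\<mu> 0\<close> vanishes modulo \<open>p\<close>.\<close>
    have "[F x y + G 0 (- y) = 0] (mod p)"
      using inc[of y "- y" 0 x] cong_scalar_right[OF base(1), of "\<phi> x"] by (auto intro: cong_trans)
    then have "[F x y + - h y = 0] (mod p)"
      using G_h[of 0 "- y"] by (metis add.inverse_inverse cong_add_lcancel cong_sym cong_trans)
    then show ?thesis by (simp add: cong_iff_dvd_diff)
  qed
  have h: "[h y - h (y - m * x) = \<mu> m * \<phi> x] (mod p)" for x y m
  proof -
    have "[F x y + G m (m * x - y) = h y + - h (- (m * x - y))] (mod p)"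
      by (rule cong_add[OF F_h G_h])
    then show ?thesis using inc[of y "m * x - y" m x] by (auto intro: cong_trans cong_sym)
  qed
  have h0: "[h 0 = 0] (mod p)" using base(4) by (simp add: h_def)
  have h_mu: "[h m = \<mu> m] (mod p)" for m
  proof -
    have "[h m - h 0 = \<mu> m * \<phi> 1] (mod p)" using h[of m m 1] by simp
    moreover have "[\<mu> m * \<phi> 1 = \<mu> m * 1] (mod p)" by (rule cong_scalar_left[OF base(6)])
    moreover have "[h m - h 0 = h m - 0] (mod p)" by (rule cong_diff[OF cong_refl h0])
    ultimately show ?thesis by (metis cong_sym cong_trans diff_zero mult.right_neutral)
  qed
  have h_phi: "[h x = \<phi> x] (mod p)" for x
  proof -
    have "[h x - h 0 = \<mu> 1 * \<phi> x] (mod p)" using h[of x 1 x] by simp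
    moreover have "[\<mu> 1 * \<phi> x = 1 * \<phi> x] (mod p)" by (rule cong_scalar_right[OF base(5)])
    moreover have "[h x - h 0 = h x - 0] (mod p)" by (rule cong_diff[OF cong_refl h0])
    ultimately show ?thesis by (metis cong_sym cong_trans diff_zero mult_1)
  qed
  \<comment> \<open>The case \<open>x = m = 1\<close>: modulo \<open>p\<close>, \<open>h\<close>
    grows by 1 at each integer step. Starting from \<open>h0\<close>, induction in both directions
    yields the identity.\<close>
  have step: "[h y - h (y - 1) = 1] (mod p)" for y
    using h[of y 1 1] cong_mult[OF base(5,6)] by (auto intro: cong_trans)
  have h_id: "[h y = y] (mod p)" for y
  proof (induction y rule: int_induct[where k = 0])
    case base then show ?case by (rule h0)
  next
    case (step1 i)
    then show ?case using cong_add[OF step[of "i + 1"] step1(2)] by (simp add: add.commute)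
  next
    case (step2 i)
    then show ?case using cong_diff[OF step2(2) step[of i]] by simp
  qed
  have "[- h (- k) = k] (mod p)" for k
    using cong_minus_minus_iff[of "h (- k)" "- k"] h_id[of "- k"] by simp
  then have "f (P x y) = P x y" "f (L m k) = L m k" for x y m k
    unfolding F G P_eq_iff L_eq_iff using F_h G_h h_phi h_mu h_id by (meson cong_sym cong_trans)+
  then show ?thesis using v by (metis vertex_cases)
qed

theorem three_arc_regular: "three_arc_regular S"
  using base_arc_in by (rule three_arc_regularI) (fact arc_reachable, fact rigid)

end

section \<open>Normal forms in the Heisenberg group\<close>

text \<open>Conjugation is an endomorphism, and endomorphisms commute with integer powers.\<close>

lemma (in group) int_pow_conjugate:
  assumes [simp]: "x \<in> carrier G" "y \<in> carrier G"
  shows "(inv x \<otimes> y \<otimes> x) [^] (i::int) = inv x \<otimes> y [^] i \<otimes> x"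
proof -
  have "(\<lambda>z. inv x \<otimes> z \<otimes> x) \<in> hom G G"
  proof (rule homI)
    fix z w assume [simp]: "z \<in> carrier G" "w \<in> carrier G"
    have "x \<otimes> (inv x \<otimes> (w \<otimes> x)) = w \<otimes> x"
      by (simp flip: m_assoc)
    then show "inv x \<otimes> (z \<otimes> w) \<otimes> x = inv x \<otimes> z \<otimes> x \<otimes> (inv x \<otimes> w \<otimes> x)"
      by (simp add: m_assoc)
  qed simp
  from hom_int_pow[OF this, of y i] show ?thesis by simp
qed

lemma (in group) conjugate_eq_iff:
  assumes [simp]: "x \<in> carrier G" "y \<in> carrier G" "z \<in> carrier G"
  shows "inv x \<otimes> y \<otimes> x = z \<longleftrightarrow> y \<otimes> x = x \<otimes> z"
  using inv_solve_left[of z x "y \<otimes> x"] by (auto simp: m_assoc)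

lemma (in group) int_pow_commute:
  assumes [simp]: "x \<in> carrier G" "y \<in> carrier G" and xy: "x \<otimes> y = y \<otimes> x"
  shows "x [^] (i::int) \<otimes> y = y \<otimes> x [^] i"
proof -
  have "inv y \<otimes> x \<otimes> y = x" using xy by (simp add: conjugate_eq_iff)
  then show ?thesis using int_pow_conjugate[of y x i] conjugate_eq_iff[of y "x [^] i" "x [^] i"] by simp
qed

section \<open>Collecting products into the form \<open>a^i b^j c^k\<close>\<close>

type_synonym heis_coords = "int \<times> int \<times> int"

text \<open>The triple \<open>(i, j, k)\<close> stands for \<open>a\<^sup>i b\<^sup>j c\<^sup>k\<close>, with exponents not reduced modulo \<open>p\<close>.
  Since \<open>b\<^sup>j a\<^sup>i = a\<^sup>i b\<^sup>j c\<^sup>-\<^sup>i\<^sup>j\<close>, they multiply as follows.\<close>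

fun heis_mult :: "heis_coords \<Rightarrow> heis_coords \<Rightarrow> heis_coords" where
  "heis_mult (i, j, k) (i', j', k') = (i + i', j + j', k + k' - j * i')"

lemma heis_mult_assoc: "heis_mult (heis_mult u v) w = heis_mult u (heis_mult v w)"
  by (cases u; cases v; cases w) (simp add: algebra_simps)

lemma heis_mult_one [simp]: "heis_mult (0, 0, 0) u = u"
  by (cases u) simp

text \<open>The commutator relations are written without inverses. Exponents range over all integers
  here; the relations of order \<open>p\<close> enter later, through
  \<open>gen_pow_cong\<close>.\<close>

locale heisenberg_generators = group G for G (structure) +
  fixes a b c
  assumes a [simp]: "a \<in> carrier G" and b [simp]: "b \<in> carrier G" and c [simp]: "c \<in> carrier G"
    and ab: "a \<otimes> b = b \<otimes> a \<otimes> c" and ca: "c \<otimes> a = a \<otimes> c" and cb: "c \<otimes> b = b \<otimes> c"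
begin

text \<open>Conjugating \<open>a\<close> by \<open>b\<close> multiplies it by the commuting element
  \<open>c\<close>, so \<open>a^i b = b a^i c^i\<close>. Read the other way, conjugating
  \<open>b\<close> by \<open>a^i\<close> gives \<open>b c^(-i)\<close>; now take \<open>j\<close>-th
  powers.\<close>

lemma b_pow_a_pow: "b [^] (j::int) \<otimes> a [^] (i::int) = a [^] i \<otimes> b [^] j \<otimes> c [^] (- (j * i))"
proof -
  have "inv b \<otimes> a \<otimes> b = a \<otimes> c"
    using ab conjugate_eq_iff[of b a "a \<otimes> c"] by (simp add: m_assoc)
  then have "inv b \<otimes> a [^] i \<otimes> b = a [^] i \<otimes> c [^] i"
    using int_pow_conjugate[of b a i] int_pow_mult_distrib[of a c i] ca by simp
  then have e: "a [^] i \<otimes> b = b \<otimes> (a [^] i \<otimes> c [^] i)"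
    by (simp add: conjugate_eq_iff)
  have "a [^] i \<otimes> (b \<otimes> c [^] (- i)) = a [^] i \<otimes> b \<otimes> c [^] (- i)"
    by (simp add: m_assoc)
  also have "\<dots> = b \<otimes> (a [^] i \<otimes> (c [^] i \<otimes> c [^] (- i)))"
    unfolding e by (simp add: m_assoc)
  also have "\<dots> = b \<otimes> a [^] i"
    by (simp flip: int_pow_mult)
  finally have "b \<otimes> a [^] i = a [^] i \<otimes> (b \<otimes> c [^] (- i))" ..
  then have "inv (a [^] i) \<otimes> b \<otimes> a [^] i = b \<otimes> c [^] (- i)"
    by (simp add: conjugate_eq_iff)
  moreover have "b \<otimes> c [^] (- i) = c [^] (- i) \<otimes> b"
    using int_pow_commute[of c b "- i"] cb by simp
  ultimately have "inv (a [^] i) \<otimes> b [^] j \<otimes> a [^] i = b [^] j \<otimes> c [^] (- i * j)"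
    using int_pow_conjugate[of "a [^] i" b j] int_pow_mult_distrib[of b "c [^] (- i)" j]
    by (simp add: int_pow_pow)
  then show ?thesis
    by (simp add: conjugate_eq_iff) (simp add: m_assoc mult.commute)
qed

definition heis_elem :: "heis_coords \<Rightarrow> 'a" where
  "heis_elem = (\<lambda>(i, j, k). a [^] i \<otimes> b [^] j \<otimes> c [^] k)"

text \<open>Powers of \<open>c\<close> move freely past powers of \<open>a\<close> and
  \<open>b\<close>. The only costly exchange is \<open>b [^] j\<close> with \<open>a [^] i'\<close>,
  which contributes \<open>c [^] (- (j * i'))\<close>.\<close>

lemma heis_elem_mult: "heis_elem u \<otimes> heis_elem v = heis_elem (heis_mult u v)"
proof -
  obtain i j k i' j' k' where u: "u = (i, j, k)" and v: "v = (i', j', k')"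
    by (cases u; cases v) auto
  have c_pow: "c [^] (n::int) \<otimes> x = x \<otimes> c [^] n" if "x \<in> {a [^] i', b [^] j'}" for n x
  proof -
    have "c \<otimes> x = x \<otimes> c"
      using that int_pow_commute[of a c i'] int_pow_commute[of b c j'] ca cb by auto
    then show ?thesis using that by (auto intro: int_pow_commute)
  qed
  have c_pow_left: "c [^] (n::int) \<otimes> (x \<otimes> y) = x \<otimes> (c [^] n \<otimes> y)"
    if "x \<in> {a [^] i', b [^] j'}" "y \<in> carrier G" for n x y
    using that c_pow[OF that(1)] m_assoc[of "c [^] n" x y] m_assoc[of x "c [^] n" y] by auto
  have "heis_elem u \<otimes> heis_elem v = a [^] i \<otimes> (b [^] j \<otimes> (c [^] k \<otimes> a [^] i') \<otimes> b [^] j' \<otimes> c [^] k')"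
    by (simp add: u v heis_elem_def m_assoc)
  also have "\<dots> = a [^] i \<otimes> ((b [^] j \<otimes> a [^] i') \<otimes> (c [^] k \<otimes> b [^] j') \<otimes> c [^] k')"
    by (simp add: c_pow_left m_assoc)
  also have "\<dots> = a [^] i \<otimes> a [^] i' \<otimes> b [^] j \<otimes> (c [^] (- (j * i')) \<otimes> b [^] j') \<otimes> c [^] k \<otimes> c [^] k'"
    by (simp add: c_pow_left b_pow_a_pow m_assoc)
  also have "\<dots> = (a [^] i \<otimes> a [^] i') \<otimes> (b [^] j \<otimes> b [^] j') \<otimes> (c [^] (- (j * i')) \<otimes> c [^] k \<otimes> c [^] k')"
    by (simp add: c_pow_left m_assoc)
  also have "\<dots> = heis_elem (heis_mult u v)"
    by (simp add: u v heis_elem_def algebra_simps flip: int_pow_mult)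
  finally show ?thesis .
qed

end

section \<open>Evaluating words in the integer Heisenberg group\<close>

fun letter_coords :: "heis_gen \<times> bool \<Rightarrow> heis_coords" where
  "letter_coords (x, e) = (let s = if e then - 1 else 1 in
    case x of GenA \<Rightarrow> (s, 0, 0) | GenB \<Rightarrow> (0, s, 0) | GenC \<Rightarrow> (0, 0, s))"

definition word_coords :: "heis_gen word \<Rightarrow> heis_coords" where
  "word_coords w = foldr (\<lambda>l. heis_mult (letter_coords l)) w (0, 0, 0)"

lemma word_coords_simps [simp]:
  "word_coords [] = (0, 0, 0)"
  "word_coords (l # w) = heis_mult (letter_coords l) (word_coords w)"
  by (simp_all add: word_coords_def)

lemma word_coords_append: "word_coords (u @ v) = heis_mult (word_coords u) (word_coords v)"
  by (induction u) (simp_all add: heis_mult_assoc)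

lemma word_coords_replicate:
  "word_coords (replicate n (x, e)) = (let s = if e then - int n else int n in
    case x of GenA \<Rightarrow> (s, 0, 0) | GenB \<Rightarrow> (0, s, 0) | GenC \<Rightarrow> (0, 0, s))"
  by (induction n) (auto simp: Let_def split: heis_gen.splits)

lemma word_coords_surj: "\<exists>w. word_coords w = u"
proof -
  obtain i j k where u: "u = (i, j, k)" by (cases u)
  have r: "word_coords (replicate (nat \<bar>n\<bar>) (x, n < 0)) =
    (case x of GenA \<Rightarrow> (n, 0, 0) | GenB \<Rightarrow> (0, n, 0) | GenC \<Rightarrow> (0, 0, n))" for n x
    by (auto simp: word_coords_replicate Let_def split: heis_gen.splits)
  have "word_coords (replicate (nat \<bar>i\<bar>) (GenA, i < 0) @ replicate (nat \<bar>j\<bar>) (GenB, j < 0) @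
      replicate (nat \<bar>k\<bar>) (GenC, k < 0)) = u"
    by (simp add: word_coords_append r u)
  then show ?thesis by blast
qed

fun heis_cong :: "nat \<Rightarrow> heis_coords \<Rightarrow> heis_coords \<Rightarrow> bool" where
  "heis_cong p (i, j, k) (i', j', k') \<longleftrightarrow>
    [i = i'] (mod int p) \<and> [j = j'] (mod int p) \<and> [k = k'] (mod int p)"

lemma heis_cong_refl: "heis_cong p u u"
  by (cases u) simp

lemma heis_cong_sym: "heis_cong p u v \<Longrightarrow> heis_cong p v u"
  by (cases u; cases v) (simp add: cong_sym)

lemma heis_cong_trans: "heis_cong p u v \<Longrightarrow> heis_cong p v w \<Longrightarrow> heis_cong p u w"
  by (cases u; cases v; cases w) (auto intro: cong_trans)

lemma heis_cong_mult:
  "heis_cong p u u' \<Longrightarrow> heis_cong p v v' \<Longrightarrow> heis_cong p (heis_mult u v) (heis_mult u' v')"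
  by (cases u; cases v; cases u'; cases v') (auto intro!: cong_add cong_diff cong_mult)

lemma word_pow_letter: "word_pow [l] n = replicate n l"
  by (induction n) (simp_all add: word_pow_def)

text \<open>The defining relations hold in the integer Heisenberg group with coordinates read modulo
  \<open>p\<close>. This model keeps the presented group from collapsing: different coordinates give
  different elements.\<close>

lemma word_coords_sound:
  assumes "pres_eq (heis_rels p) u v"
  shows "heis_cong p (word_coords u) (word_coords v)"
  using assms
proof induction
  case (relation u v)
  then show ?case
    by (auto simp: heis_rels_def Let_def word_pow_letter word_coords_replicate cong_0_iff
        word_comm_def word_inv_def gen_word_def)
next
  case (cancel x e)
  then show ?case by (cases x) auto
next
  case (sym u v)
  then show ?case by (simp add: heis_cong_sym)
next
  case (trans u v w)
  then show ?case by (blast intro: heis_cong_trans)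
qed (simp_all add: heis_cong_refl word_coords_append heis_cong_mult)

section \<open>Existence and uniqueness of normal forms in the presented group\<close>

context
  fixes p :: nat
begin

interpretation group "heis_group p"
  unfolding heis_group_def by (rule group_presented_group)

definition heis_c :: "heis_gen word set" where
  "heis_c = pres_class (heis_rels p) (gen_word GenC)"

lemma carrier_heis_group: "carrier (heis_group p) = range (pres_class (heis_rels p))"
  by (simp add: heis_group_def presented_group_def)

lemma class_in_heis_group [simp]: "pres_class (heis_rels p) u \<in> carrier (heis_group p)"
  by (auto simp: carrier_heis_group)

lemma one_heis_group: "\<one>\<^bsub>heis_group p\<^esub> = pres_class (heis_rels p) []"
  by (simp add: heis_group_def presented_group_def)

lemma mult_heis_group:
  "pres_class (heis_rels p) u \<otimes>\<^bsub>heis_group p\<^esub> pres_class (heis_rels p) v = pres_class (heis_rels p) (u @ v)"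
  by (simp add: heis_group_def presented_group_mult)

lemma inv_heis_group:
  "inv\<^bsub>heis_group p\<^esub> (pres_class (heis_rels p) u) = pres_class (heis_rels p) (word_inv u)"
  by (rule inv_equality)
    (simp_all add: mult_heis_group one_heis_group pres_class_eq_iff pres_eq_word_inv)

lemma word_comm_class:
  "pres_class (heis_rels p) u \<otimes>\<^bsub>heis_group p\<^esub> pres_class (heis_rels p) v =
   pres_class (heis_rels p) v \<otimes>\<^bsub>heis_group p\<^esub> pres_class (heis_rels p) u
     \<otimes>\<^bsub>heis_group p\<^esub> pres_class (heis_rels p) (word_comm u v)"
proof -
  let ?u = "pres_class (heis_rels p) u" and ?v = "pres_class (heis_rels p) v"
  have cancel: "x \<otimes>\<^bsub>heis_group p\<^esub> (inv\<^bsub>heis_group p\<^esub> x \<otimes>\<^bsub>heis_group p\<^esub> y) = y"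
    if "x \<in> carrier (heis_group p)" "y \<in> carrier (heis_group p)" for x y
    using that by (simp flip: m_assoc)
  have comm: "pres_class (heis_rels p) (word_comm u v) =
     inv\<^bsub>heis_group p\<^esub> ?u \<otimes>\<^bsub>heis_group p\<^esub> (inv\<^bsub>heis_group p\<^esub> ?v \<otimes>\<^bsub>heis_group p\<^esub>
       (?u \<otimes>\<^bsub>heis_group p\<^esub> ?v))"
    by (simp add: word_comm_def inv_heis_group mult_heis_group)
  show ?thesis
    unfolding comm by (simp add: m_assoc cancel)
qed

lemma heis_rel_class:
  "(u, v) \<in> heis_rels p \<Longrightarrow> pres_class (heis_rels p) u = pres_class (heis_rels p) v"
  by (simp add: pres_class_eq_iff pres_eq.relation)

lemma heis_generators: "heisenberg_generators (heis_group p) (heis_a p) (heis_b p) heis_c"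
proof
  note defs = heis_a_def heis_b_def heis_c_def
  show "heis_a p \<in> carrier (heis_group p)" "heis_b p \<in> carrier (heis_group p)"
    "heis_c \<in> carrier (heis_group p)"
    by (simp_all add: defs)
  have "(word_comm (gen_word GenA) (gen_word GenB), gen_word GenC) \<in> heis_rels p"
    "(word_comm (gen_word GenC) (gen_word GenA), []) \<in> heis_rels p"
    "(word_comm (gen_word GenC) (gen_word GenB), []) \<in> heis_rels p"
    by (simp_all add: heis_rels_def Let_def)
  note rels = this[THEN heis_rel_class]
  show "heis_a p \<otimes>\<^bsub>heis_group p\<^esub> heis_b p = heis_b p \<otimes>\<^bsub>heis_group p\<^esub> heis_a p \<otimes>\<^bsub>heis_group p\<^esub> heis_c"
    unfolding defs by (simp only: word_comm_class[of "gen_word GenA" "gen_word GenB"] rels)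
  show "heis_c \<otimes>\<^bsub>heis_group p\<^esub> heis_a p = heis_a p \<otimes>\<^bsub>heis_group p\<^esub> heis_c"
    unfolding defs word_comm_class[of "gen_word GenC" "gen_word GenA"] rels
    by (simp flip: one_heis_group)
  show "heis_c \<otimes>\<^bsub>heis_group p\<^esub> heis_b p = heis_b p \<otimes>\<^bsub>heis_group p\<^esub> heis_c"
    unfolding defs word_comm_class[of "gen_word GenC" "gen_word GenB"] rels
    by (simp flip: one_heis_group)
qed

interpretation heisenberg_generators "heis_group p" "heis_a p" "heis_b p" heis_c
  by (rule heis_generators)

lemma gen_pow_p:
  assumes "x \<in> {heis_a p, heis_b p, heis_c}"
  shows "x [^]\<^bsub>heis_group p\<^esub> p = \<one>\<^bsub>heis_group p\<^esub>"
proof -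
  have pow: "pres_class (heis_rels p) u [^]\<^bsub>heis_group p\<^esub> n = pres_class (heis_rels p) (word_pow u n)" for u n
  proof (induction n)
    case 0 show ?case by (simp add: one_heis_group word_pow_def)
  next
    case (Suc n)
    have "word_pow u (Suc n) = word_pow u n @ u"
      by (simp add: word_pow_def flip: replicate_append_same)
    then show ?case using Suc by (simp add: mult_heis_group)
  qed
  have "pres_class (heis_rels p) (word_pow (gen_word y) p) = pres_class (heis_rels p) []" for y
    by (rule heis_rel_class) (cases y; simp add: heis_rels_def Let_def)
  then show ?thesis
    using assms by (auto simp: heis_a_def heis_b_def heis_c_def pow one_heis_group)
qed

lemma gen_pow_cong:
  assumes "x \<in> {heis_a p, heis_b p, heis_c}" "[i = j] (mod int p)"
  shows "x [^]\<^bsub>heis_group p\<^esub> i = x [^]\<^bsub>heis_group p\<^esub> j"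
proof -
  have x: "x \<in> carrier (heis_group p)" using assms(1) by auto
  obtain n where "j = i + int p * n" using assms(2) by (auto simp: cong_iff_lin)
  then have "x [^]\<^bsub>heis_group p\<^esub> j =
      x [^]\<^bsub>heis_group p\<^esub> i \<otimes>\<^bsub>heis_group p\<^esub> (x [^]\<^bsub>heis_group p\<^esub> int p) [^]\<^bsub>heis_group p\<^esub> n"
    using x by (simp add: int_pow_mult int_pow_pow)
  also have "x [^]\<^bsub>heis_group p\<^esub> int p = \<one>\<^bsub>heis_group p\<^esub>"
    using gen_pow_p[OF assms(1)] by (simp add: int_pow_int)
  finally show ?thesis using x by simp
qed

text \<open>Each letter is already in normal form, and \<open>heis_elem_mult\<close> collects the
  product letter by letter.\<close>

lemma class_eq_heis_elem: "pres_class (heis_rels p) w = heis_elem (word_coords w)"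
proof (induction w)
  case Nil
  show ?case by (simp add: heis_elem_def flip: one_heis_group)
next
  case (Cons l w)
  obtain x e where l: "l = (x, e)" by (cases l)
  let ?g = "pres_class (heis_rels p) (gen_word x)"
  have "pres_class (heis_rels p) [l] = heis_elem (letter_coords l)"
  proof (cases e)
    case True
    have "inv\<^bsub>heis_group p\<^esub> ?g = heis_elem (letter_coords (x, True))"
      by (cases x) (simp_all add: heis_elem_def int_pow_neg flip: heis_a_def heis_b_def heis_c_def)
    then show ?thesis using True by (simp add: l inv_heis_group gen_word_def word_inv_def)
  next
    case False
    have "?g = heis_elem (letter_coords (x, False))"
      by (cases x) (simp_all add: heis_elem_def flip: heis_a_def heis_b_def heis_c_def)
    then show ?thesis using False by (simp add: l gen_word_def)
  qed
  then show ?case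
    using Cons mult_heis_group[of "[l]" w] heis_elem_mult[of "letter_coords l" "word_coords w"] by simp
qed

text \<open>Equal elements have congruent coordinates: realise both triples by words and apply
  \<open>word_coords_sound\<close>. Conversely, the generators have trivial \<open>p\<close>-th
  power, so exponents matter only modulo \<open>p\<close>.\<close>

lemma heis_elem_eq_iff: "heis_elem u = heis_elem v \<longleftrightarrow> heis_cong p u v"
proof
  obtain w w' where "u = word_coords w" "v = word_coords w'" using word_coords_surj by metis
  then show "heis_elem u = heis_elem v \<Longrightarrow> heis_cong p u v"
    using word_coords_sound by (simp add: pres_class_eq_iff flip: class_eq_heis_elem)
  obtain i j k i' j' k' where uv: "u = (i, j, k)" "v = (i', j', k')" by (cases u; cases v)
  assume "heis_cong p u v"
  then show "heis_elem u = heis_elem v"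
    using gen_pow_cong[of "heis_a p" i i'] gen_pow_cong[of "heis_b p" j j'] gen_pow_cong[of heis_c k k']
    by (simp add: uv heis_elem_def)
qed

lemma carrier_eq_heis_elem: "carrier (heis_group p) = range heis_elem"
proof -
  have "heis_elem u \<in> range (pres_class (heis_rels p))" for u
    using word_coords_surj[of u] class_eq_heis_elem by (metis rangeI)
  then show ?thesis by (auto simp: carrier_heis_group class_eq_heis_elem)
qed

section \<open>Cosets as points and lines\<close>

abbreviation (input) "subgroup_a \<equiv> generate (heis_group p) {heis_a p}"
abbreviation (input) "subgroup_b \<equiv> generate (heis_group p) {heis_b p}"

lemma coset_A: "subgroup_a #>\<^bsub>heis_group p\<^esub> heis_elem (i, j, k) = {heis_elem (i', j, k) | i'. True}"
proof -
  have "subgroup_a = {heis_elem (n, 0, 0) | n. True}"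
    by (simp add: generate_pow heis_elem_def)
  then have "subgroup_a #>\<^bsub>heis_group p\<^esub> heis_elem (i, j, k) = {heis_elem (n + i, j, k) | n. True}"
    by (auto simp: r_coset_def heis_elem_mult)
  also have "\<dots> = {heis_elem (i', j, k) | i'. True}"
    by auto (metis diff_add_cancel)
  finally show ?thesis .
qed

text \<open>Left multiplication by \<open>b^n\<close> sends \<open>(i, j, k)\<close> to
  \<open>(i, n + j, k - n * i)\<close>, so \<open>i\<close> and \<open>k + j * i\<close> are the
  invariants of the coset.\<close>

lemma coset_B: "subgroup_b #>\<^bsub>heis_group p\<^esub> heis_elem (i, j, k) = {heis_elem (i, j', k') | j' k'. k' + j' * i = k + j * i}"
proof -
  have "subgroup_b = {heis_elem (0, n, 0) | n. True}"
    by (simp add: generate_pow heis_elem_def)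
  then have "subgroup_b #>\<^bsub>heis_group p\<^esub> heis_elem (i, j, k) = {heis_elem (i, n + j, k - n * i) | n. True}"
    by (auto simp: r_coset_def heis_elem_mult)
  also have "\<dots> = {heis_elem (i, j', k') | j' k'. k' + j' * i = k + j * i}"
  proof (intro equalityI subsetI)
    fix z assume "z \<in> {heis_elem (i, n + j, k - n * i) | n. True}"
    then obtain n where "z = heis_elem (i, n + j, k - n * i)" by blast
    moreover have "k - n * i + (n + j) * i = k + j * i" by (simp add: algebra_simps)
    ultimately show "z \<in> {heis_elem (i, j', k') | j' k'. k' + j' * i = k + j * i}" by blast
  next
    fix z assume "z \<in> {heis_elem (i, j', k') | j' k'. k' + j' * i = k + j * i}"
    then obtain j' k' where z: "z = heis_elem (i, j', k')" "k' + j' * i = k + j * i" by blast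
    then have "k' = k - (j' - j) * i" "j' = (j' - j) + j" by (simp_all add: algebra_simps)
    then have "z = heis_elem (i, (j' - j) + j, k - (j' - j) * i)" using z(1) by simp
    then show "z \<in> {heis_elem (i, n + j, k - n * i) | n. True}" by blast
  qed
  finally show ?thesis .
qed

text \<open>The minus sign turns the meeting condition \<open>- y + x * m = k\<close> with
  \<open>line m k\<close> into the symmetric equation \<open>y + k = m * x\<close>.\<close>

definition point :: "int \<Rightarrow> int \<Rightarrow> heis_gen word set set" where
  "point x y = subgroup_a #>\<^bsub>heis_group p\<^esub> heis_elem (0, x, - y)"

definition line :: "int \<Rightarrow> int \<Rightarrow> heis_gen word set set" where
  "line m k = subgroup_b #>\<^bsub>heis_group p\<^esub> heis_elem (m, 0, k)"

lemma mem_point: "heis_elem (i, j, k) \<in> point x y \<longleftrightarrow> [j = x] (mod int p) \<and> [k = - y] (mod int p)"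
  unfolding point_def coset_A mem_Collect_eq heis_elem_eq_iff by (auto intro: cong_refl)

lemma mem_line: "heis_elem (i, j, k) \<in> line m n \<longleftrightarrow> [i = m] (mod int p) \<and> [k + j * i = n] (mod int p)"
proof
  assume "heis_elem (i, j, k) \<in> line m n"
  then obtain j' k' where "heis_cong p (i, j, k) (m, j', k')" "k' + j' * m = n"
    unfolding line_def coset_B heis_elem_eq_iff[symmetric] by auto
  then show "[i = m] (mod int p) \<and> [k + j * i = n] (mod int p)"
    by (auto intro!: cong_add cong_mult)
next
  assume *: "[i = m] (mod int p) \<and> [k + j * i = n] (mod int p)"
  have "[k + j * i = k + j * m] (mod int p)" using * by (auto intro!: cong_add cong_mult)
  then have "[k + j * m = n] (mod int p)" using * by (metis cong_sym cong_trans)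
  then have "[k = n - j * m] (mod int p)" by (simp add: cong_iff_dvd_diff algebra_simps)
  then have "heis_elem (i, j, k) = heis_elem (m, j, n - j * m)"
    using * by (simp add: heis_elem_eq_iff)
  moreover have "heis_elem (m, j, n - j * m) \<in> line m n"
    unfolding line_def coset_B by (intro CollectI exI[of _ j] exI[of _ "n - j * m"]) simp
  ultimately show "heis_elem (i, j, k) \<in> line m n" by simp
qed

lemma coset_A_point: "subgroup_a #>\<^bsub>heis_group p\<^esub> heis_elem (i, j, k) = point j (- k)"
  unfolding point_def coset_A by simp

lemma coset_B_line: "subgroup_b #>\<^bsub>heis_group p\<^esub> heis_elem (i, j, k) = line i (k + j * i)"
  unfolding line_def coset_B by simp

lemma point_subset: "point x y \<subseteq> range heis_elem" and line_subset: "line m k \<subseteq> range heis_elem"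
  unfolding point_def coset_A line_def coset_B by auto

lemma biaffine_graph_heis:
  assumes "prime p"
  shows "biaffine_graph (int p) (Cos (heis_group p) subgroup_a subgroup_b) point line"
proof
  show "prime (int p)" using assms by simp
  show "point x y = point x' y' \<longleftrightarrow> [x = x'] (mod int p) \<and> [y = y'] (mod int p)" for x y x' y'
  proof
    assume "point x y = point x' y'"
    then have "heis_elem (0, x, - y) \<in> point x' y'" using mem_point[of 0 x "- y" x y] by simp
    then show "[x = x'] (mod int p) \<and> [y = y'] (mod int p)"
      unfolding mem_point cong_minus_minus_iff .
  next
    assume *: "[x = x'] (mod int p) \<and> [y = y'] (mod int p)"
    have "heis_elem u \<in> point x y \<longleftrightarrow> heis_elem u \<in> point x' y'" for u
    proof (cases u)
      case (fields i j k)
      have "[- y = - y'] (mod int p)" using * by (simp add: cong_minus_minus_iff)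
      then show ?thesis unfolding fields mem_point using * by (meson cong_sym cong_trans)
    qed
    then show "point x y = point x' y'" using point_subset by blast
  qed
  show "line x y = line x' y' \<longleftrightarrow> [x = x'] (mod int p) \<and> [y = y'] (mod int p)" for x y x' y'
  proof
    assume "line x y = line x' y'"
    then have "heis_elem (x, 0, y) \<in> line x' y'" using mem_line[of x 0 y x y] by simp
    then show "[x = x'] (mod int p) \<and> [y = y'] (mod int p)"
      unfolding mem_line by simp
  next
    assume *: "[x = x'] (mod int p) \<and> [y = y'] (mod int p)"
    have "heis_elem u \<in> line x y \<longleftrightarrow> heis_elem u \<in> line x' y'" for u
    proof (cases u)
      case (fields i j k)
      show ?thesis unfolding fields mem_line using * by (meson cong_sym cong_trans)
    qed
    then show "line x y = line x' y'" using line_subset by blast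
  qed
  show "point x y \<noteq> line m k" for x y m k
  proof
    assume "point x y = line m k"
    \<comment> \<open>A point contains elements with every exponent of \<open>a\<close>, whereas a
      line fixes that exponent modulo \<open>p\<close>; the exponents 0 and 1 clash.\<close>
    then have "heis_elem (i, x, - y) \<in> line m k" for i using mem_point[of i x "- y" x y] by simp
    then have "[0 = m] (mod int p)" "[1 = m] (mod int p)" unfolding mem_line by blast+
    then have "[1 = 0] (mod int p)" by (meson cong_sym cong_trans)
    then show False using \<open>prime (int p)\<close> by (auto simp: cong_0_iff)
  qed
  have heis_elem_ex: "(\<exists>g\<in>carrier (heis_group p). Q g) \<longleftrightarrow> (\<exists>i j k. Q (heis_elem (i, j, k)))" for Q
    by (auto simp: carrier_eq_heis_elem)
  have rcosets_a: "rcosets\<^bsub>heis_group p\<^esub> subgroup_a = {point x y | x y. True}"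
  proof -
    have "rcosets\<^bsub>heis_group p\<^esub> subgroup_a = {v. \<exists>g\<in>carrier (heis_group p). v = subgroup_a #>\<^bsub>heis_group p\<^esub> g}"
      by (auto simp: RCOSETS_def)
    also have "\<dots> = {point x (- y) | x y. True}"
      unfolding heis_elem_ex coset_A_point by simp
    also have "\<dots> = {point x y | x y. True}"
      by auto (metis minus_minus)
    finally show ?thesis .
  qed
  have rcosets_b: "rcosets\<^bsub>heis_group p\<^esub> subgroup_b = {line x y | x y. True}"
  proof -
    have "rcosets\<^bsub>heis_group p\<^esub> subgroup_b = {v. \<exists>g\<in>carrier (heis_group p). v = subgroup_b #>\<^bsub>heis_group p\<^esub> g}"
      by (auto simp: RCOSETS_def)
    also have "\<dots> = {line i (k + j * i) | i j k. True}"
      unfolding heis_elem_ex coset_B_line by simp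
    also have "\<dots> = {line x y | x y. True}"
      by auto (metis add_0_right mult_zero_left)
    finally show ?thesis .
  qed
  show "vertices (Cos (heis_group p) subgroup_a subgroup_b) = {point x y | x y. True} \<union> {line m k | m k. True}"
    by (simp add: Cos_def rcosets_a rcosets_b)
  have meet: "point x y \<inter> line m k \<noteq> {} \<longleftrightarrow> [y + k = m * x] (mod int p)" for x y m k
  proof
    assume "point x y \<inter> line m k \<noteq> {}"
    then obtain u where "heis_elem u \<in> point x y" "heis_elem u \<in> line m k"
      using point_subset[of x y] by blast
    then obtain i j l where "heis_elem (i, j, l) \<in> point x y" "heis_elem (i, j, l) \<in> line m k"
      by (cases u) auto
    then have c: "[j = x] (mod int p)" "[l = - y] (mod int p)" "[i = m] (mod int p)" "[l + j * i = k] (mod int p)"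
      unfolding mem_point mem_line by auto
    have "[l + j * i = - y + x * m] (mod int p)" using c by (intro cong_add cong_mult)
    then have "[- y + x * m = k] (mod int p)" using c(4) by (meson cong_sym cong_trans)
    then have "[y + (- y + x * m) = y + k] (mod int p)" by (rule cong_add[OF cong_refl])
    then show "[y + k = m * x] (mod int p)" by (intro cong_sym[of "m * x"]) (simp add: mult.commute)
  next
    assume "[y + k = m * x] (mod int p)"
    then have "[- y + (y + k) = - y + x * m] (mod int p)"
      by (intro cong_add cong_refl) (simp add: mult.commute)
    \<comment> \<open>The common element: the line prescribes the exponent \<open>m\<close> of
      \<open>a\<close>, the point prescribes the exponents \<open>x\<close> of \<open>b\<close> and
      \<open>- y\<close> of \<open>c\<close>.\<close>
    then have "heis_elem (m, x, - y) \<in> line m k" unfolding mem_line by (intro conjI cong_sym[of k]) simp_all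
    moreover have "heis_elem (m, x, - y) \<in> point x y" unfolding mem_point by simp
    ultimately show "point x y \<inter> line m k \<noteq> {}" by blast
  qed
  have "edges (Cos (heis_group p) subgroup_a subgroup_b) = {{u, v} | u v.
      u \<in> rcosets\<^bsub>heis_group p\<^esub> subgroup_a \<and> v \<in> rcosets\<^bsub>heis_group p\<^esub> subgroup_b \<and> u \<inter> v \<noteq> {}}"
    by (auto simp: Cos_def RCOSETS_def)
  also have "\<dots> = {{point x y, line m k} | x y m k. [y + k = m * x] (mod int p)}"
    unfolding rcosets_a rcosets_b meet[symmetric] by blast
  finally show "edges (Cos (heis_group p) subgroup_a subgroup_b) = {{point x y, line m k} | x y m k. [y + k = m * x] (mod int p)}" .
qed

end

theorem mainTheorem3:
  fixes p :: nat
  assumes "prime p" and "odd p"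
  shows "three_arc_regular
    (Cos (heis_group p)
      (generate (heis_group p) {heis_a p})
      (generate (heis_group p) {heis_b p}))"
  using biaffine_graph.three_arc_regular[OF biaffine_graph_heis[OF assms(1)]] .

end
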